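(* $\mathsf{CtoB}$ commutes with addition, multiplication, and exponentiation with base $\omega$.
   Context: $\mathsf{Cnf}$ is the type of Cantor normal forms: binary trees built from $0$ (leaf) and $\omega^a+b$ (node with left subtree $a$, right subtree $b$) such that for every node $\omega^s+t$ contained in the tree, the left subtree of $t$ (or $0$ if $t=0$) is $\le s$ in the lexicographic order. On $\mathsf{Cnf}$, addition is $0+b=b$, $a+0=a$, $(\omega^a+c)+(\omega^b+d)=\omega^b+d$ if $a<b$ and $\omega^a+(c+(\omega^b+d))$ otherwise; multiplication is $0\cdot b=0$, $a\cdot 0=0$, $a\cdot(\omega^0+d)=a+a\cdot d$, $(\omega^a+c)\cdot(\omega^b+d)=\omega^{a+b}+0+(\omega^a+c)\cdot d$ if $b\ne0$; exponentiation with base $\omega$ sends $a$ to $\omega^a+0$. $\mathsf{Brw}$ is the quotient inductive-inductive type of Brouwer trees (constructors $\mathsf{zero}$, $\mathsf{succ}$, $\mathsf{limit}$ of strictly increasing sequences, with bisimilar sequences having equal limits), with addition, multiplication and exponentiation defined by recursion on the second argument ($x+\mathsf{zero}=x$, $x+\mathsf{succ}\,y=\mathsf{succ}(x+y)$, $x+\mathsf{limit}\,f=\mathsf{limit}(\lambda k.\,x+f\,k)$, and analogously for multiplication and exponentiation), and $\omega := \mathsf{limit}\,\iota$ where $\iota:\mathbb N\to\mathsf{Brw}$ embeds the finite trees. The map $\mathsf{CtoB}:\mathsf{Cnf}\to\mathsf{Brw}$ is defined by $\mathsf{CtoB}(0)=\mathsf{zero}$ and $\mathsf{CtoB}(\omega^a+b)=\omega^{\mathsf{CtoB}(a)}+\mathsf{CtoB}(b)$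 (Brouwer-tree exponentiation and addition on the right). *)

theory Defs
  imports Main
begin

section \<open>Cantor normal forms\<close>

datatype tree = Leaf | Node tree tree

primrec left :: "tree \<Rightarrow> tree" where
  "left Leaf = Leaf"
| "left (Node a b) = a"

inductive tree_less :: "tree \<Rightarrow> tree \<Rightarrow> bool" where
  "tree_less Leaf (Node a b)"
| "tree_less a c \<Longrightarrow> tree_less (Node a b) (Node c d)"
| "tree_less b d \<Longrightarrow> tree_less (Node a b) (Node a d)"

definition tree_le :: "tree \<Rightarrow> tree \<Rightarrow> bool" where
  "tree_le s t \<longleftrightarrow> tree_less s t \<or> s = t"

primrec is_cnf :: "tree \<Rightarrow> bool" where
  "is_cnf Leaf \<longleftrightarrow> True"
| "is_cnf (Node s t) \<longleftrightarrow> is_cnf s \<and> is_cnf t \<and> tree_le (left t) s"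

fun tree_add :: "tree \<Rightarrow> tree \<Rightarrow> tree" where
  "tree_add Leaf b = b"
| "tree_add a Leaf = a"
| "tree_add (Node a c) (Node b d) =
     (if tree_less a b then Node b d else Node a (tree_add c (Node b d)))"

fun tree_mul :: "tree \<Rightarrow> tree \<Rightarrow> tree" where
  "tree_mul Leaf b = Leaf"
| "tree_mul a Leaf = Leaf"
| "tree_mul a (Node Leaf d) = tree_add a (tree_mul a d)"
| "tree_mul (Node a c) (Node b d) =
     tree_add (Node (tree_add a b) Leaf) (tree_mul (Node a c) d)"

lemma tree_less_linear: "tree_less s t \<or> s = t \<or> tree_less t s"
proof (induction s arbitrary: t)
  case Leaf
  then show ?case by (cases t) (auto intro: tree_less.intros)
next
  case (Node a b)
  then show ?case by (cases t) (auto intro: tree_less.intros)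
qed

lemma left_tree_add: "left (tree_add a b) = left a \<or> left (tree_add a b) = left b"
  by (cases "(a, b)" rule: tree_add.cases) auto

lemma is_cnf_tree_add: "is_cnf a \<Longrightarrow> is_cnf b \<Longrightarrow> is_cnf (tree_add a b)"
proof (induction a b rule: tree_add.induct)
  case (3 a c b d)
  have "tree_le (left (tree_add c (Node b d))) a" if "\<not> tree_less a b"
    using left_tree_add[of c "Node b d"] tree_less_linear[of a b] that 3
    by (auto simp: tree_le_def)
  with 3 show ?case by auto
qed auto

lemma is_cnf_tree_mul: "is_cnf a \<Longrightarrow> is_cnf b \<Longrightarrow> is_cnf (tree_mul a b)"
proof (induction a b rule: tree_mul.induct)
  case (4 a c b1 b2 d)
  have "is_cnf (Node (tree_add a (Node b1 b2)) Leaf)"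
    using 4 is_cnf_tree_add[of a "Node b1 b2"] tree_less.intros(1)
    by (cases "tree_add a (Node b1 b2)") (auto simp: tree_le_def)
  with 4 show ?case by (auto simp del: is_cnf.simps(2) intro!: is_cnf_tree_add) auto
qed (auto intro!: is_cnf_tree_add simp del: tree_add.simps)

typedef cnf = "{t. is_cnf t}"
  morphisms tree_of_cnf Abs_cnf
  by (rule exI[of _ Leaf]) simp

setup_lifting type_definition_cnf

instantiation cnf :: "{zero, plus, times}"
begin

lift_definition zero_cnf :: cnf is Leaf by simp
lift_definition plus_cnf :: "cnf \<Rightarrow> cnf \<Rightarrow> cnf" is tree_add by (rule is_cnf_tree_add)
lift_definition times_cnf :: "cnf \<Rightarrow> cnf \<Rightarrow> cnf" is tree_mul by (rule is_cnf_tree_mul)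

instance ..

end

lift_definition cnf_omega_exp :: "cnf \<Rightarrow> cnf" is "\<lambda>a. Node a Leaf"
  by (case_tac tree) (auto simp: tree_le_def intro: tree_less.intros)


section \<open>Brouwer trees\<close>

text \<open>
  The quotient inductive-inductive type is presented as a quotient of raw trees.  The three
  mutually inductive predicates below are the well-formedness of raw trees (limits are taken
  only of strictly increasing sequences, where \<open>x < y\<close> abbreviates \<open>succ x \<le> y\<close>), the equality
  that is generated by the identification of limits of bisimilar sequences, and the order, which
  is generated by its constructors and respects the generated equality.
\<close>

datatype raw = RZero | RSucc raw | RLim "nat \<Rightarrow> raw"

inductive rwf :: "raw \<Rightarrow> bool"
  and req :: "raw \<Rightarrow> raw \<Rightarrow> bool"
  and rle :: "raw \<Rightarrow> raw \<Rightarrow> bool"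
where
  rwf_zero: "rwf RZero"
| rwf_succ: "rwf x \<Longrightarrow> rwf (RSucc x)"
| rwf_lim: "(\<And>k. rwf (f k)) \<Longrightarrow> (\<And>k. rle (RSucc (f k)) (f (Suc k))) \<Longrightarrow> rwf (RLim f)"

| req_refl: "rwf x \<Longrightarrow> req x x"
| req_sym: "req x y \<Longrightarrow> req y x"
| req_trans: "req x y \<Longrightarrow> req y z \<Longrightarrow> req x z"
| req_succ: "req x y \<Longrightarrow> req (RSucc x) (RSucc y)"
| req_lim: "rwf (RLim f) \<Longrightarrow> rwf (RLim g) \<Longrightarrow> (\<And>k. req (f k) (g k)) \<Longrightarrow> req (RLim f) (RLim g)"
| req_bisim: "rwf (RLim f) \<Longrightarrow> rwf (RLim g) \<Longrightarrow>
    (\<And>k. \<exists>n. rle (f k) (g n)) \<Longrightarrow> (\<And>k. \<exists>n. rle (g k) (f n)) \<Longrightarrow> req (RLim f) (RLim g)"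

| rle_zero: "rwf x \<Longrightarrow> rle RZero x"
| rle_trans: "rle x y \<Longrightarrow> rle y z \<Longrightarrow> rle x z"
| rle_succ_mono: "rle x y \<Longrightarrow> rle (RSucc x) (RSucc y)"
| rle_cocone: "rwf (RLim f) \<Longrightarrow> rle x (f k) \<Longrightarrow> rle x (RLim f)"
| rle_limiting: "rwf (RLim f) \<Longrightarrow> (\<And>k. rle (f k) x) \<Longrightarrow> rle (RLim f) x"
| rle_cong: "req x x' \<Longrightarrow> req y y' \<Longrightarrow> rle x y \<Longrightarrow> rle x' y'"

lemma rwf_of_raw:
  shows "rwf x \<Longrightarrow> True" and req_rwf: "req x y \<Longrightarrow> rwf x \<and> rwf y"
    and rle_rwf: "rle x y \<Longrightarrow> rwf x \<and> rwf y"
  by (induction rule: rwf_req_rle.inducts) (auto intro: rwf_succ rwf_zero)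

quotient_type brw = raw / partial: req
  morphisms rep_brw abs_brw
proof (rule part_equivpI)
  show "\<exists>x. req x x" by (blast intro: req_refl rwf_zero)
  show "symp req" by (blast intro: sympI req_sym)
  show "transp req" by (blast intro: transpI req_trans)
qed

lift_definition brw_zero :: brw is RZero by (intro req_refl rwf_zero)
lift_definition brw_succ :: "brw \<Rightarrow> brw" is RSucc by (rule req_succ)

instantiation brw :: ord
begin

lift_definition less_eq_brw :: "brw \<Rightarrow> brw \<Rightarrow> bool" is rle by (blast intro: rle_cong req_sym)
definition less_brw :: "brw \<Rightarrow> brw \<Rightarrow> bool" where "x < y \<longleftrightarrow> brw_succ x \<le> y"

instance ..

end

definition strictly_increasing :: "(nat \<Rightarrow> brw) \<Rightarrow> bool" where
  "strictly_increasing f \<longleftrightarrow> (\<forall>k. f k < f (Suc k))"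

definition bisimilar :: "(nat \<Rightarrow> brw) \<Rightarrow> (nat \<Rightarrow> brw) \<Rightarrow> bool" where
  "bisimilar f g \<longleftrightarrow> (\<forall>k. \<exists>n. f k \<le> g n) \<and> (\<forall>k. \<exists>n. g k \<le> f n)"

text \<open>The value is meaningful only when \<open>strictly_increasing f\<close>.\<close>

definition brw_limit :: "(nat \<Rightarrow> brw) \<Rightarrow> brw" where
  "brw_limit f = abs_brw (RLim (\<lambda>k. rep_brw (f k)))"


subsection \<open>Arithmetic on raw trees\<close>

text \<open>
  Multiplication of zero by a limit, and exponentiation of zero or one to a limit, are separate
  cases because the sequence of results is not strictly increasing there.
\<close>

primrec radd :: "raw \<Rightarrow> raw \<Rightarrow> raw" where
  "radd x RZero = x"
| "radd x (RSucc y) = RSucc (radd x y)"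
| "radd x (RLim f) = RLim (\<lambda>k. radd x (f k))"

primrec rmul :: "raw \<Rightarrow> raw \<Rightarrow> raw" where
  "rmul x RZero = RZero"
| "rmul x (RSucc y) = radd (rmul x y) x"
| "rmul x (RLim f) = (if x = RZero then RZero else RLim (\<lambda>k. rmul x (f k)))"

primrec rexp :: "raw \<Rightarrow> raw \<Rightarrow> raw" where
  "rexp x RZero = RSucc RZero"
| "rexp x (RSucc y) = rmul (rexp x y) x"
| "rexp x (RLim f) =
     (if x = RZero then RZero else if x = RSucc RZero then RSucc RZero
      else RLim (\<lambda>k. rexp x (f k)))"

lemma rle_refl: "rwf x \<Longrightarrow> rle x x"
proof (induction x)
  case (RLim f)
  have "rwf (f k)" for k using RLim.prems by cases auto
  with RLim show ?case by (auto intro!: rle_limiting intro: rle_cocone)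
qed (auto intro: rle_zero rle_succ_mono elim: rwf.cases)

lemma req_rle: "req x y \<Longrightarrow> rle x y"
  using rle_cong req_refl rle_refl req_rwf by blast

lemma rwf_limD:
  assumes "rwf (RLim f)"
  shows "rwf (f k)" "rle (RSucc (f k)) (f (Suc k))" "rle (f k) (RLim f)"
proof -
  show "rwf (f k)" "rle (RSucc (f k)) (f (Suc k))" using assms by (cases; auto)+
  then show "rle (f k) (RLim f)" using assms rle_cocone rle_refl by blast
qed

lemma rwf_succD: "rwf (RSucc x) \<Longrightarrow> rwf x"
  by (auto elim: rwf.cases)

lemma rle_succ: "rwf x \<Longrightarrow> rle x (RSucc x)"
proof (induction x)
  case (RLim f)
  then have "rle (f k) (RSucc (RLim f))" for k
    using rwf_limD[OF RLim.prems, of k] by (blast intro: rle_trans rle_succ_mono)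
  with RLim.prems show ?case by (blast intro: rle_limiting)
qed (auto intro: rle_zero rle_succ_mono rwf_succ rwf_zero dest: rwf_succD)

abbreviation "ROne \<equiv> RSucc RZero"

lemma small_aux:
  shows "rwf x \<Longrightarrow> \<forall>f. x = RLim f \<longrightarrow> (\<exists>k. f k \<noteq> RZero \<and> f k \<noteq> ROne)"
    and "req x y \<Longrightarrow> (x = RZero \<longleftrightarrow> y = RZero) \<and> (x = ROne \<longleftrightarrow> y = ROne)"
    and "rle x y \<Longrightarrow> (y = RZero \<longrightarrow> x = RZero) \<and> (y = ROne \<longrightarrow> x = RZero \<or> x = ROne)"
proof (induction rule: rwf_req_rle.inducts)
  case (rwf_lim f)
  then show ?case by (metis raw.distinct(1) raw.inject(1) raw.inject(2))
next
  case (rle_limiting f x)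
  then show ?case by blast
qed auto

lemma req_zero_iff: "req x y \<Longrightarrow> x = RZero \<longleftrightarrow> y = RZero"
  and req_one_iff: "req x y \<Longrightarrow> x = ROne \<longleftrightarrow> y = ROne"
  and rle_zeroD: "rle x y \<Longrightarrow> y = RZero \<Longrightarrow> x = RZero"
  using small_aux by blast+

lemma one_rle: "rwf a \<Longrightarrow> a \<noteq> RZero \<Longrightarrow> rle ROne a"
proof (cases a)
  case (RLim f)
  moreover assume "rwf a"
  ultimately show ?thesis
    using rwf_limD[of f] by (metis rle_cocone rle_succ_mono rle_trans rle_zero)
qed (auto intro: rle_succ_mono rle_zero dest: rwf_succD)

lemma two_rle: "rwf a \<Longrightarrow> a \<noteq> RZero \<Longrightarrow> a \<noteq> ROne \<Longrightarrow> rle (RSucc ROne) a"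
proof (cases a)
  case (RLim f)
  moreover assume "rwf a"
  moreover have "rle (RSucc ROne) (RSucc (f (Suc 0)))"
    using calculation rwf_limD[of f]
    by (metis rle_succ_mono rle_trans rle_zero)
  ultimately show ?thesis
    using rwf_limD[of f] by (metis rle_trans)
qed (auto intro: rle_succ_mono one_rle dest: rwf_succD)

lemma radd_right:
  assumes a: "rwf a"
  shows "rwf y \<Longrightarrow> rwf (radd a y) \<and> rle a (radd a y)"
    and "req y y' \<Longrightarrow> req (radd a y) (radd a y')"
    and "rle y y' \<Longrightarrow> rle (radd a y) (radd a y')"
proof (induction rule: rwf_req_rle.inducts)
  case (rwf_succ x)
  then show ?case using rle_succ rle_trans rwf_req_rle.rwf_succ by auto
next
  case (rwf_lim f)
  then have "rwf (radd a (RLim f))" by (auto intro: rwf_req_rle.rwf_lim)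
  with rwf_lim show ?case by (auto intro: rle_cocone)
next
  case (req_bisim f g)
  then show ?case by (auto intro!: rwf_req_rle.req_bisim)
next
  case (rle_cong x x' y y')
  then show ?case using rwf_req_rle.rle_cong by blast
next
  case (rle_trans x y z)
  then show ?case using rwf_req_rle.rle_trans by blast
next
  case (req_trans x y z)
  then show ?case using rwf_req_rle.req_trans by blast
next
  case (req_sym x y)
  then show ?case using rwf_req_rle.req_sym by blast
qed (auto intro: rwf_req_rle.intros(1,2,4) req_succ req_lim rle_succ_mono rle_cocone rle_limiting
       a rle_refl)

lemma rwf_radd: "rwf a \<Longrightarrow> rwf y \<Longrightarrow> rwf (radd a y)"
  using radd_right by blast

lemma radd_left:
  assumes "rwf y"
  shows "rle a a' \<Longrightarrow> rle (radd a y) (radd a' y)" "req a a' \<Longrightarrow> req (radd a y) (radd a' y)"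
proof -
  show "rle (radd a y) (radd a' y)" if le: "rle a a'" using assms
  proof (induction y rule: raw.induct)
    case (RLim f)
    have "rwf (radd a (RLim f))" "rwf (radd a' (RLim f))"
      using le RLim.prems rle_rwf rwf_radd by blast+
    with RLim rwf_limD show ?case by (auto intro!: rle_limiting intro: rle_cocone)
  qed (auto intro: le rle_succ_mono dest: rwf_succD)
  show "req (radd a y) (radd a' y)" if eq: "req a a'" using assms
  proof (induction y rule: raw.induct)
    case (RLim f)
    have "rwf (radd a (RLim f))" "rwf (radd a' (RLim f))"
      using eq RLim.prems req_rwf rwf_radd by blast+
    with RLim rwf_limD show ?case by (auto intro!: req_lim)
  qed (auto intro: eq req_succ dest: rwf_succD)
qed

lemma radd_cong: "req a a' \<Longrightarrow> req y y' \<Longrightarrow> req (radd a y) (radd a' y')"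
  by (meson radd_left(2) radd_right(2) req_rwf req_trans)

lemma radd_mono: "rle a a' \<Longrightarrow> rle y y' \<Longrightarrow> rle (radd a y) (radd a' y')"
  by (meson radd_left(1) radd_right(3) rle_rwf rle_trans)

lemma radd_zero_left [simp]: "radd RZero y = y"
  by (induction y) auto

lemma rmul_zero_left [simp]: "rmul RZero y = RZero"
  by (induction y) auto

lemma rsucc_rle_radd:
  assumes "rwf u" "rwf a" "a \<noteq> RZero"
  shows "rle (RSucc u) (radd u a)"
  using radd_right(3)[OF assms(1) one_rle[OF assms(2,3)]] by simp

lemma rmul_right_pos:
  assumes a: "rwf a" "a \<noteq> RZero"
  shows "rwf y \<Longrightarrow> rwf (rmul a y)"
    and "req y y' \<Longrightarrow> req (rmul a y) (rmul a y')"
    and "rle y y' \<Longrightarrow> rle (rmul a y) (rmul a y')"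
proof (induction rule: rwf_req_rle.inducts)
  case (rwf_lim f)
  have "rle (RSucc (rmul a (f k))) (rmul a (f (Suc k)))" for k
    using rwf_lim rsucc_rle_radd[of "rmul a (f k)" a] a rle_trans by auto
  with rwf_lim a show ?case by (auto intro: rwf_req_rle.rwf_lim)
next
  case (req_bisim f g)
  then show ?case using a by (auto intro!: rwf_req_rle.req_bisim)
next
  case (rle_cong x x' y y')
  then show ?case using rwf_req_rle.rle_cong by blast
next
  case (rle_trans x y z)
  then show ?case using rwf_req_rle.rle_trans by blast
next
  case (req_trans x y z)
  then show ?case using rwf_req_rle.req_trans by blast
next
  case (req_sym x y)
  then show ?case using rwf_req_rle.req_sym by blast
next
  case (rle_cocone f x k)
  then show ?case using a by (auto intro: rwf_req_rle.rle_cocone)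
next
  case (rle_limiting f x)
  then show ?case using a by (auto intro: rwf_req_rle.rle_limiting)
qed (auto intro: rwf_zero rle_zero req_refl req_lim radd_cong radd_mono rwf_radd rle_refl a)

lemma rwf_rmul: "rwf a \<Longrightarrow> rwf y \<Longrightarrow> rwf (rmul a y)"
  using rmul_right_pos(1)[of a y] rwf_zero by (cases "a = RZero") auto

lemma rmul_right:
  assumes "rwf a"
  shows "req y y' \<Longrightarrow> req (rmul a y) (rmul a y')" "rle y y' \<Longrightarrow> rle (rmul a y) (rmul a y')"
  using rmul_right_pos(2,3)[of a y y'] assms rwf_zero req_refl rle_refl
  by (cases "a = RZero"; simp)+

lemma rmul_left:
  assumes "rwf y"
  shows "rle a a' \<Longrightarrow> rle (rmul a y) (rmul a' y)" "req a a' \<Longrightarrow> req (rmul a y) (rmul a' y)"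
proof -
  show "rle (rmul a y) (rmul a' y)" if le: "rle a a'" using assms
  proof (induction y rule: raw.induct)
    case (RLim f)
    have wf: "rwf (rmul a (RLim f))" "rwf (rmul a' (RLim f))"
      using le RLim.prems rle_rwf rwf_rmul by blast+
    have "a' = RZero \<Longrightarrow> a = RZero" using le rle_zeroD by blast
    with wf RLim rwf_limD[OF RLim.prems] show ?case
      by (auto intro!: rle_limiting intro: rle_cocone rle_zero split: if_splits)
  qed (auto intro: rle_zero rwf_zero radd_mono le dest: rwf_succD)
  show "req (rmul a y) (rmul a' y)" if eq: "req a a'" using assms
  proof (induction y rule: raw.induct)
    case (RLim f)
    have wf: "rwf (rmul a (RLim f))" "rwf (rmul a' (RLim f))"
      using eq RLim.prems req_rwf rwf_rmul by blast+
    have "a' = RZero \<longleftrightarrow> a = RZero" using eq req_zero_iff by blast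
    with wf RLim rwf_limD[OF RLim.prems] show ?case
      by (auto intro!: req_lim intro: req_refl split: if_splits)
  qed (auto intro: req_refl rwf_zero radd_cong eq dest: rwf_succD)
qed

lemma rmul_cong: "req a a' \<Longrightarrow> req y y' \<Longrightarrow> req (rmul a y) (rmul a' y')"
  by (meson rmul_left(2) rmul_right(1) req_rwf req_trans)

lemma rmul_mono: "rle a a' \<Longrightarrow> rle y y' \<Longrightarrow> rle (rmul a y) (rmul a' y')"
  by (meson rmul_left(1) rmul_right(2) rle_rwf rle_trans)

lemma rsucc_rle_rmul:
  assumes u: "rwf u" "u \<noteq> RZero" and a: "rwf a" "a \<noteq> RZero" "a \<noteq> ROne"
  shows "rle (RSucc u) (rmul u a)"
proof -
  have "rle (radd u u) (rmul u a)"
    using rmul_right(2)[OF u(1) two_rle[OF a]] by simp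
  with rsucc_rle_radd[OF u(1) u] show ?thesis by (rule rle_trans)
qed

lemma rexp_right_big:
  assumes a: "rwf a" "a \<noteq> RZero" "a \<noteq> ROne"
  shows "rwf y \<Longrightarrow> rwf (rexp a y) \<and> rle ROne (rexp a y)"
    and "req y y' \<Longrightarrow> req (rexp a y) (rexp a y')"
    and "rle y y' \<Longrightarrow> rle (rexp a y) (rexp a y')"
proof (induction rule: rwf_req_rle.inducts)
  case rwf_zero
  then show ?case by (auto intro: rle_refl rwf_req_rle.rwf_zero rwf_req_rle.rwf_succ)
next
  case (rwf_succ x)
  moreover have "rexp a x \<noteq> RZero" using rwf_succ rle_zeroD by blast
  ultimately have "rle (RSucc (rexp a x)) (rexp a (RSucc x))"
    using rsucc_rle_rmul a by simp
  then have "rle ROne (rexp a (RSucc x))"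
    using rwf_succ rle_trans rle_succ by blast
  with rwf_succ show ?case using a by (simp add: rwf_rmul)
next
  case (rwf_lim f)
  have "rle (RSucc (rexp a (f k))) (rexp a (f (Suc k)))" for k
  proof -
    have "rexp a (f k) \<noteq> RZero" using rwf_lim rle_zeroD by blast
    then show ?thesis
      using rwf_lim rsucc_rle_rmul[of "rexp a (f k)" a] a rle_trans by auto
  qed
  with rwf_lim have "rwf (RLim (\<lambda>k. rexp a (f k)))" by (auto intro: rwf_req_rle.rwf_lim)
  with rwf_lim a show ?case by (auto intro: rle_cocone)
next
  case (req_bisim f g)
  then show ?case using a by (auto intro!: rwf_req_rle.req_bisim)
next
  case (rle_cong x x' y y')
  then show ?case using rwf_req_rle.rle_cong by blast
next
  case (rle_trans x y z)
  then show ?case using rwf_req_rle.rle_trans by blast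
next
  case (req_trans x y z)
  then show ?case using rwf_req_rle.req_trans by blast
next
  case (req_sym x y)
  then show ?case using rwf_req_rle.req_sym by blast
next
  case (rle_cocone f x k)
  then show ?case using a by (auto intro: rwf_req_rle.rle_cocone)
next
  case (rle_limiting f x)
  then show ?case using a by (auto intro: rwf_req_rle.rle_limiting)
qed (auto intro: req_refl req_lim rmul_cong rmul_mono rle_refl a)

lemma rexp_zero_left: "rexp RZero y = (if y = RZero then ROne else RZero)"
  by (cases y) (auto simp: req_refl)

lemma rexp_one_left: "rexp ROne y = ROne"
  by (induction y) auto

lemma rwf_rexp: "rwf a \<Longrightarrow> rwf y \<Longrightarrow> rwf (rexp a y)"
  using rexp_right_big(1)[of a y] rwf_zero rwf_succ rexp_zero_left rexp_one_left
  by (cases "a = RZero"; cases "a = ROne"; simp)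

lemma rexp_right: "rwf a \<Longrightarrow> req y y' \<Longrightarrow> req (rexp a y) (rexp a y')"
  using rexp_right_big(2)[of a y y'] req_zero_iff[of y y'] rexp_zero_left rexp_one_left
    req_refl rwf_zero rwf_succ
  by (cases "a = RZero"; cases "a = ROne"; simp)

lemma rexp_left: "rwf y \<Longrightarrow> req a a' \<Longrightarrow> req (rexp a y) (rexp a' y)"
proof (induction y)
  case (RLim f)
  have wf: "rwf (rexp a (RLim f))" "rwf (rexp a' (RLim f))"
    using RLim.prems req_rwf rwf_rexp by blast+
  have "a' = RZero \<longleftrightarrow> a = RZero" "a' = ROne \<longleftrightarrow> a = ROne"
    using RLim.prems req_zero_iff req_one_iff by blast+
  with wf RLim rwf_limD[OF RLim.prems(1)] show ?case
    by (auto intro!: req_lim intro: req_refl split: if_splits)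
qed (auto intro: req_refl rwf_zero rwf_succ rmul_cong dest: rwf_succD)

lemma rexp_cong: "req a a' \<Longrightarrow> req y y' \<Longrightarrow> req (rexp a y) (rexp a' y')"
  by (meson rexp_left rexp_right req_rwf req_trans)


subsection \<open>Arithmetic on Brouwer trees\<close>

instantiation brw :: "{plus, times}"
begin

lift_definition plus_brw :: "brw \<Rightarrow> brw \<Rightarrow> brw" is radd by (rule radd_cong)
lift_definition times_brw :: "brw \<Rightarrow> brw \<Rightarrow> brw" is rmul by (rule rmul_cong)

instance ..

end

lift_definition brw_exp :: "brw \<Rightarrow> brw \<Rightarrow> brw" is rexp by (rule rexp_cong)

primrec brw_of_nat :: "nat \<Rightarrow> brw" where
  "brw_of_nat 0 = brw_zero"
| "brw_of_nat (Suc n) = brw_succ (brw_of_nat n)"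

definition brw_omega :: brw where
  "brw_omega = brw_limit brw_of_nat"


subsection \<open>Characteristic properties\<close>

text \<open>
  The facts below express the constructors, the induction principle and the recursion equations
  on the quotient itself.
\<close>

lemma req_rep_abs: "rwf x \<Longrightarrow> req (rep_brw (abs_brw x)) x"
  by (rule Quotient_rep_abs[OF Quotient_brw req_refl])

lemma rwf_rep: "rwf (rep_brw x)"
  using Quotient_rep_reflp[OF Quotient_brw] req_rwf by blast

lemma abs_rep_brw [simp]: "abs_brw (rep_brw x) = x"
  by (rule Quotient_abs_rep[OF Quotient_brw])

lemma abs_brw_eqI: "req x y \<Longrightarrow> abs_brw x = abs_brw y"
  by (rule Quotient_rel_abs[OF Quotient_brw])

lemma le_brw_iff: "x \<le> y \<longleftrightarrow> rle (rep_brw x) (rep_brw y)"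
  by (simp add: less_eq_brw_def)

lemma brw_succ_abs: "rwf x \<Longrightarrow> brw_succ (abs_brw x) = abs_brw (RSucc x)"
  by (simp add: brw_succ.abs_eq req_refl)

lemma rwf_rlim_rep: "rwf (RLim (\<lambda>k. rep_brw (f k))) \<longleftrightarrow> strictly_increasing f"
proof -
  have "f k < f (Suc k) \<longleftrightarrow> rle (RSucc (rep_brw (f k))) (rep_brw (f (Suc k)))" for k
    unfolding less_brw_def le_brw_iff brw_succ_def map_fun_apply
    using req_rep_abs[OF rwf_succ[OF rwf_rep]] rle_cong req_sym req_refl rwf_rep
    by (metis (no_types))
  then show ?thesis
    unfolding strictly_increasing_def using rwf_limD(2) rwf_rep rwf_lim by metis
qed

lemma abs_brw_lim:
  assumes "rwf (RLim g)"
  shows "strictly_increasing (\<lambda>k. abs_brw (g k))" "abs_brw (RLim g) = brw_limit (\<lambda>k. abs_brw (g k))"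
proof -
  have eq: "req (g k) (rep_brw (abs_brw (g k)))" for k
    using req_rep_abs req_sym rwf_limD(1)[OF assms] by blast
  have "rle (RSucc (rep_brw (abs_brw (g k)))) (rep_brw (abs_brw (g (Suc k))))" for k
    using rwf_limD(2)[OF assms, of k] eq req_succ rle_cong by blast
  then have wf: "rwf (RLim (\<lambda>k. rep_brw (abs_brw (g k))))" by (auto intro: rwf_lim rwf_rep)
  then show "strictly_increasing (\<lambda>k. abs_brw (g k))" by (simp add: rwf_rlim_rep)
  show "abs_brw (RLim g) = brw_limit (\<lambda>k. abs_brw (g k))"
    unfolding brw_limit_def using req_lim[OF assms wf eq] by (rule abs_brw_eqI)
qed

theorem brw_induct [case_names zero succ limit]:
  assumes "P brw_zero" and "\<And>x. P x \<Longrightarrow> P (brw_succ x)"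
    and "\<And>f. strictly_increasing f \<Longrightarrow> (\<And>k. P (f k)) \<Longrightarrow> P (brw_limit f)"
  shows "P x"
proof -
  have "rwf r \<Longrightarrow> P (abs_brw r)" for r
  proof (induction r)
    case RZero
    then show ?case using assms(1) by (simp add: brw_zero_def)
  next
    case (RSucc r)
    then show ?case using assms(2) rwf_succD brw_succ_abs by metis
  next
    case (RLim g)
    then show ?case using assms(3) abs_brw_lim[OF RLim.prems] rwf_limD(1) by auto
  qed
  from this[OF rwf_rep] show ?thesis by simp
qed

theorem brw_limit_bisim:
  assumes "strictly_increasing f" "strictly_increasing g" "bisimilar f g"
  shows "brw_limit f = brw_limit g"
  unfolding brw_limit_def
  using assms
  by (intro abs_brw_eqI req_bisim) (auto simp: bisimilar_def le_brw_iff rwf_rlim_rep)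

lemma rle_imp_le: "rle x y \<Longrightarrow> abs_brw x \<le> abs_brw y"
  unfolding le_brw_iff using req_rep_abs req_sym rle_cong rle_rwf by metis

theorem brw_le_intros:
  fixes x y z :: brw
  shows "brw_zero \<le> x"
    and "x \<le> y \<Longrightarrow> y \<le> z \<Longrightarrow> x \<le> z"
    and "x \<le> y \<Longrightarrow> brw_succ x \<le> brw_succ y"
    and "strictly_increasing f \<Longrightarrow> x \<le> f k \<Longrightarrow> x \<le> brw_limit f"
    and "strictly_increasing f \<Longrightarrow> (\<And>k. f k \<le> x) \<Longrightarrow> brw_limit f \<le> x"
proof -
  show "brw_zero \<le> x"
    using rle_imp_le[OF rle_zero[OF rwf_rep, of x]] by (simp add: brw_zero_def)
  show "x \<le> y \<Longrightarrow> y \<le> z \<Longrightarrow> x \<le> z"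
    unfolding le_brw_iff by (rule rle_trans)
  show "x \<le> y \<Longrightarrow> brw_succ x \<le> brw_succ y"
    using rle_imp_le[OF rle_succ_mono] by (simp add: le_brw_iff brw_succ_def)
  show "strictly_increasing f \<Longrightarrow> x \<le> f k \<Longrightarrow> x \<le> brw_limit f"
    using rle_imp_le[OF rle_cocone, of "\<lambda>k. rep_brw (f k)" "rep_brw x" k]
    by (simp add: rwf_rlim_rep le_brw_iff[of x "f k"] brw_limit_def)
  show "strictly_increasing f \<Longrightarrow> (\<And>k. f k \<le> x) \<Longrightarrow> brw_limit f \<le> x"
    using rle_imp_le[OF rle_limiting, of "\<lambda>k. rep_brw (f k)" "rep_brw x"]
    by (simp add: rwf_rlim_rep le_brw_iff[of "f _" x] brw_limit_def)
qed

lemma strictly_increasing_brw_of_nat: "strictly_increasing brw_of_nat"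
  by (simp add: strictly_increasing_def less_brw_def le_brw_iff rle_refl rwf_rep)

lemma plus_brw_abs: "rwf x \<Longrightarrow> rwf y \<Longrightarrow> abs_brw x + abs_brw y = abs_brw (radd x y)"
  by (simp add: plus_brw.abs_eq req_refl)

lemma times_brw_abs: "rwf x \<Longrightarrow> rwf y \<Longrightarrow> abs_brw x * abs_brw y = abs_brw (rmul x y)"
  by (simp add: times_brw.abs_eq req_refl)

lemma brw_exp_abs: "rwf x \<Longrightarrow> rwf y \<Longrightarrow> brw_exp (abs_brw x) (abs_brw y) = abs_brw (rexp x y)"
  by (simp add: brw_exp.abs_eq req_refl)

lemma rep_eq_zero_iff: "rep_brw x = RZero \<longleftrightarrow> x = brw_zero"
  using req_zero_iff[OF req_rep_abs[OF rwf_zero]] abs_rep_brw[of x] unfolding brw_zero_def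
  by metis

lemma rep_eq_one_iff: "rep_brw x = ROne \<longleftrightarrow> x = brw_succ brw_zero"
  using req_one_iff[OF req_rep_abs[OF rwf_succ[OF rwf_zero]]] abs_rep_brw[of x]
    brw_succ_abs[OF rwf_zero]
  unfolding brw_zero_def by metis

lemma brw_succ_rep: "brw_succ x = abs_brw (RSucc (rep_brw x))"
  by (simp add: brw_succ_def)

theorem brw_add_simps:
  fixes x y :: brw
  shows "x + brw_zero = x"
    and "x + brw_succ y = brw_succ (x + y)"
    and "strictly_increasing f \<Longrightarrow> x + brw_limit f = brw_limit (\<lambda>k. x + f k)"
proof -
  have rx: "rwf (rep_brw x)" and ry: "rwf (rep_brw y)" by (rule rwf_rep)+
  show "x + brw_zero = x"
    using plus_brw_abs[OF rx rwf_zero] by (simp add: brw_zero_def)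
  show "x + brw_succ y = brw_succ (x + y)"
    using plus_brw_abs[OF rx ry] plus_brw_abs[OF rx rwf_succ[OF ry]]
      brw_succ_abs[OF rwf_radd[OF rx ry]]
    by (simp add: brw_succ_rep[of y])
  show "x + brw_limit f = brw_limit (\<lambda>k. x + f k)" if "strictly_increasing f"
  proof -
    have rf: "rwf (RLim (\<lambda>k. rep_brw (f k)))" using that by (simp add: rwf_rlim_rep)
    show ?thesis
      using plus_brw_abs[OF rx rf] abs_brw_lim(2)[of "\<lambda>k. radd (rep_brw x) (rep_brw (f k))"]
        rwf_radd[OF rx rf] plus_brw_abs[OF rx rwf_rep, of "f _"]
      by (simp add: brw_limit_def[of f])
  qed
qed

theorem brw_mul_simps:
  fixes x y :: brw
  shows "x * brw_zero = brw_zero"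
    and "x * brw_succ y = x * y + x"
    and "strictly_increasing f \<Longrightarrow> x \<noteq> brw_zero \<Longrightarrow> x * brw_limit f = brw_limit (\<lambda>k. x * f k)"
    and "strictly_increasing f \<Longrightarrow> brw_zero * brw_limit f = brw_zero"
proof -
  have rx: "rwf (rep_brw x)" and ry: "rwf (rep_brw y)" by (rule rwf_rep)+
  show "x * brw_zero = brw_zero"
    using times_brw_abs[OF rx rwf_zero] by (simp add: brw_zero_def)
  show "x * brw_succ y = x * y + x"
    using times_brw_abs[OF rx ry] times_brw_abs[OF rx rwf_succ[OF ry]]
      plus_brw_abs[OF rwf_rmul[OF rx ry] rx]
    by (simp add: brw_succ_rep[of y])
  show "x * brw_limit f = brw_limit (\<lambda>k. x * f k)" if "strictly_increasing f" "x \<noteq> brw_zero"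
  proof -
    have rf: "rwf (RLim (\<lambda>k. rep_brw (f k)))" using that by (simp add: rwf_rlim_rep)
    show ?thesis
      using times_brw_abs[OF rx rf] abs_brw_lim(2)[of "\<lambda>k. rmul (rep_brw x) (rep_brw (f k))"]
        rwf_rmul[OF rx rf] times_brw_abs[OF rx rwf_rep, of "f _"] that(2)
      by (simp add: brw_limit_def[of f] rep_eq_zero_iff)
  qed
  show "brw_zero * brw_limit f = brw_zero" if "strictly_increasing f"
    using times_brw_abs[OF rwf_zero, of "RLim (\<lambda>k. rep_brw (f k))"] that
    by (simp add: brw_limit_def[of f] rwf_rlim_rep brw_zero_def)
qed

theorem brw_exp_simps:
  fixes x y :: brw
  shows "brw_exp x brw_zero = brw_succ brw_zero"
    and "brw_exp x (brw_succ y) = brw_exp x y * x"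
    and "strictly_increasing f \<Longrightarrow> x \<noteq> brw_zero \<Longrightarrow> x \<noteq> brw_succ brw_zero \<Longrightarrow>
      brw_exp x (brw_limit f) = brw_limit (\<lambda>k. brw_exp x (f k))"
    and "strictly_increasing f \<Longrightarrow> brw_exp brw_zero (brw_limit f) = brw_zero"
    and "strictly_increasing f \<Longrightarrow>
      brw_exp (brw_succ brw_zero) (brw_limit f) = brw_succ brw_zero"
proof -
  have rx: "rwf (rep_brw x)" and ry: "rwf (rep_brw y)" by (rule rwf_rep)+
  show "brw_exp x brw_zero = brw_succ brw_zero"
    using brw_exp_abs[OF rx rwf_zero] by (simp add: brw_zero_def brw_succ_abs rwf_zero)
  show "brw_exp x (brw_succ y) = brw_exp x y * x"
    using brw_exp_abs[OF rx ry] brw_exp_abs[OF rx rwf_succ[OF ry]]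
      times_brw_abs[OF rwf_rexp[OF rx ry] rx]
    by (simp add: brw_succ_rep[of y])
  show "brw_exp x (brw_limit f) = brw_limit (\<lambda>k. brw_exp x (f k))"
    if "strictly_increasing f" "x \<noteq> brw_zero" "x \<noteq> brw_succ brw_zero"
  proof -
    have rf: "rwf (RLim (\<lambda>k. rep_brw (f k)))" using that by (simp add: rwf_rlim_rep)
    show ?thesis
      using brw_exp_abs[OF rx rf] abs_brw_lim(2)[of "\<lambda>k. rexp (rep_brw x) (rep_brw (f k))"]
        rwf_rexp[OF rx rf] brw_exp_abs[OF rx rwf_rep, of "f _"] that(2,3)
      by (simp add: brw_limit_def[of f] rep_eq_zero_iff rep_eq_one_iff)
  qed
  show "brw_exp brw_zero (brw_limit f) = brw_zero" if "strictly_increasing f"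
    using brw_exp_abs[OF rwf_zero, of "RLim (\<lambda>k. rep_brw (f k))"] that
    by (simp add: brw_limit_def[of f] rwf_rlim_rep brw_zero_def)
  show "brw_exp (brw_succ brw_zero) (brw_limit f) = brw_succ brw_zero"
    if "strictly_increasing f"
    using brw_exp_abs[OF rwf_succ[OF rwf_zero], of "RLim (\<lambda>k. rep_brw (f k))"] that
    by (simp add: brw_limit_def[of f] rwf_rlim_rep brw_zero_def brw_succ_abs rwf_zero)
qed


section \<open>The translation\<close>

primrec tree_to_brw :: "tree \<Rightarrow> brw" where
  "tree_to_brw Leaf = brw_zero"
| "tree_to_brw (Node a b) = brw_exp brw_omega (tree_to_brw a) + tree_to_brw b"

definition CtoB :: "cnf \<Rightarrow> brw" where
  "CtoB a = tree_to_brw (tree_of_cnf a)"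

end

(* No antisymmetry, and hardly any inversion, of the order on Brouwer trees is needed: a strict
   inequality s < t of normal forms is turned into an equation CtoB t = succ (CtoB s) + r.
   With B = succ A + r one gets omega^B = omega^A * omega * omega^r, so that 1 + omega = omega
   gives the absorption law omega^A + omega^B = omega^B, which settles addition.  For
   multiplication, a normal form omega^a + c lies between omega^a and a finite multiple of it,
   so both have the same product with omega. *)
theory Submission
  imports Defs
begin

section \<open>Order and limits of Brouwer trees\<close>

lemma brw_le_refl: "(x::brw) \<le> x"
  by (simp add: le_brw_iff rle_refl rwf_rep)

lemma brw_le_zeroD: "x \<le> brw_zero \<Longrightarrow> x = brw_zero"
  using brw_le_intros(1) rep_eq_zero_iff rle_zeroD unfolding le_brw_iff by metis

lemma brw_le_limit: "strictly_increasing f \<Longrightarrow> f k \<le> brw_limit f"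
  by (rule brw_le_intros(4)[OF _ brw_le_refl])

lemma brw_succ_neq_zero: "brw_succ x \<noteq> brw_zero"
proof -
  have "req (rep_brw (brw_succ x)) (RSucc (rep_brw x))"
    by (simp add: brw_succ_rep req_rep_abs rwf_rep rwf_succ)
  then show ?thesis using req_zero_iff rep_eq_zero_iff by blast
qed

lemma brw_limit_neq:
  assumes "strictly_increasing f"
  shows "brw_limit f \<noteq> brw_zero" "brw_limit f \<noteq> brw_succ brw_zero"
proof -
  have "req (rep_brw (brw_limit f)) (RLim (\<lambda>k. rep_brw (f k)))"
    using assms by (simp add: brw_limit_def req_rep_abs rwf_rlim_rep)
  then show "brw_limit f \<noteq> brw_zero" "brw_limit f \<noteq> brw_succ brw_zero"
    using req_zero_iff rep_eq_zero_iff req_one_iff rep_eq_one_iff by blast+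
qed

lemma brw_add_mono: "a \<le> b \<Longrightarrow> c \<le> d \<Longrightarrow> a + c \<le> b + (d::brw)"
  by transfer (rule radd_mono)

lemma brw_mul_mono: "a \<le> b \<Longrightarrow> c \<le> d \<Longrightarrow> a * c \<le> b * (d::brw)"
  by transfer (rule rmul_mono)

text \<open>A raw limit of representatives is well formed exactly when its sequence is strictly
  increasing, so closure of \<open>rwf\<close> under \<open>radd\<close> at a limit gives this. The
  products and powers below are handled alike.\<close>

lemma strictly_increasing_add:
  assumes "strictly_increasing f"
  shows "strictly_increasing (\<lambda>k. x + f k)"
proof -
  have "rwf (radd (rep_brw x) (RLim (\<lambda>k. rep_brw (f k))))"
    using assms by (intro rwf_radd) (simp_all add: rwf_rep rwf_rlim_rep)
  then show ?thesis
    using abs_brw_lim(1)[of "\<lambda>k. radd (rep_brw x) (rep_brw (f k))"]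
      plus_brw_abs[OF rwf_rep rwf_rep, of x "f _"] by simp
qed

lemma strictly_increasing_mul:
  assumes "strictly_increasing f" "x \<noteq> brw_zero"
  shows "strictly_increasing (\<lambda>k. x * f k)"
proof -
  have "rwf (rmul (rep_brw x) (RLim (\<lambda>k. rep_brw (f k))))"
    using assms by (intro rwf_rmul) (simp_all add: rwf_rep rwf_rlim_rep)
  then show ?thesis
    using abs_brw_lim(1)[of "\<lambda>k. rmul (rep_brw x) (rep_brw (f k))"] assms(2)
      times_brw_abs[OF rwf_rep rwf_rep, of x "f _"] by (simp add: rep_eq_zero_iff)
qed

lemma strictly_increasing_exp:
  assumes "strictly_increasing f" "x \<noteq> brw_zero" "x \<noteq> brw_succ brw_zero"
  shows "strictly_increasing (\<lambda>k. brw_exp x (f k))"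
proof -
  have "rwf (rexp (rep_brw x) (RLim (\<lambda>k. rep_brw (f k))))"
    using assms by (intro rwf_rexp) (simp_all add: rwf_rep rwf_rlim_rep)
  then show ?thesis
    using abs_brw_lim(1)[of "\<lambda>k. rexp (rep_brw x) (rep_brw (f k))"] assms(2,3)
      brw_exp_abs[OF rwf_rep rwf_rep, of x "f _"]
    by (simp add: rep_eq_zero_iff rep_eq_one_iff)
qed


section \<open>Arithmetic of Brouwer trees\<close>

lemma brw_add_assoc: "x + y + z = x + (y + (z::brw))"
  by (induction z rule: brw_induct)
    (simp_all add: brw_add_simps strictly_increasing_add)

lemma brw_add_zero_left: "brw_zero + x = x"
  by (induction x rule: brw_induct) (simp_all add: brw_add_simps)

lemma brw_mul_zero_left: "brw_zero * x = brw_zero"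
  by (induction x rule: brw_induct) (simp_all add: brw_mul_simps brw_add_simps)

lemma brw_mul_one: "x * brw_succ brw_zero = x"
  by (simp add: brw_mul_simps brw_add_zero_left)

lemma brw_add_eq_zeroD:
  assumes "x + y = brw_zero"
  shows "x = brw_zero"
  using brw_add_mono[OF brw_le_refl[of x] brw_le_intros(1)[of y]] assms
  by (simp add: brw_add_simps brw_le_zeroD)

lemma brw_le_one_add: "x \<le> brw_succ brw_zero + x"
  using brw_add_mono[OF brw_le_intros(1) brw_le_refl] by (metis brw_add_zero_left)

lemma brw_one_add_le: "brw_succ brw_zero + x \<le> brw_succ x"
proof (induction x rule: brw_induct)
  case (limit f)
  have "brw_succ (f k) \<le> brw_succ (brw_limit f)" for k
    by (intro brw_le_intros(3) brw_le_limit limit.hyps)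
  then show ?case
    using limit brw_le_intros(2)[OF limit.IH]
    by (auto simp: brw_add_simps intro!: brw_le_intros(5) strictly_increasing_add)
qed (simp_all add: brw_add_simps brw_le_refl brw_le_intros(3))

text \<open>One plus \<open>f k\<close> lies between \<open>f k\<close> and
  \<open>f (Suc k)\<close>, so prefixing a one yields a bisimilar sequence.\<close>

lemma brw_one_add_limit:
  assumes f: "strictly_increasing f"
  shows "brw_succ brw_zero + brw_limit f = brw_limit f"
proof -
  have "brw_succ brw_zero + f k \<le> f (Suc k)" for k
    using f brw_one_add_le brw_le_intros(2)
    unfolding strictly_increasing_def less_brw_def by blast
  then have "bisimilar (\<lambda>k. brw_succ brw_zero + f k) f"
    unfolding bisimilar_def using brw_le_one_add by blast
  with f show ?thesis
    by (simp add: brw_add_simps brw_limit_bisim strictly_increasing_add)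
qed

text \<open>Left subtraction of one, which exposes a nonzero tree to distributivity and absorption.
  At a limit the remainder is the limit itself.\<close>

lemma brw_one_add_cases:
  assumes "x \<noteq> brw_zero"
  obtains r where "x = brw_succ brw_zero + r"
proof -
  have "x = brw_zero \<or> (\<exists>r. x = brw_succ brw_zero + r)"
  proof (induction x rule: brw_induct)
    case (succ x)
    then show ?case by (metis brw_add_simps(1,2))
  next
    case (limit f)
    then show ?case by (metis brw_one_add_limit)
  qed simp
  with assms that show ?thesis by blast
qed

lemma brw_distrib_left: "x * (y + z) = x * y + x * (z::brw)"
proof (cases "x = brw_zero")
  case True
  then show ?thesis by (simp add: brw_mul_zero_left brw_add_simps)
next
  case False
  then show ?thesis
    by (induction z rule: brw_induct)
      (simp_all add: brw_add_simps brw_mul_simps brw_add_assoc strictly_increasing_add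
        strictly_increasing_mul)
qed

text \<open>Splitting one off \<open>y\<close> gives \<open>x * y = x + x * r\<close>, and a sum
  vanishes only if its left summand does.\<close>

lemma brw_mul_neq_zero: "x \<noteq> brw_zero \<Longrightarrow> y \<noteq> brw_zero \<Longrightarrow> x * y \<noteq> brw_zero"
  by (metis brw_one_add_cases brw_distrib_left brw_mul_one brw_add_eq_zeroD)

lemma brw_mul_assoc: "x * y * z = x * (y * (z::brw))"
\<comment> \<open>The limit equation for products asks for a nonzero left factor: here
  \<open>x\<close>, \<open>y\<close> and \<open>x * y\<close>.\<close>
proof (cases "x = brw_zero \<or> y = brw_zero")
  case True
  then show ?thesis by (auto simp: brw_mul_zero_left brw_mul_simps)
next
  case False
  then show ?thesis
    by (induction z rule: brw_induct)
      (simp_all add: brw_mul_simps brw_distrib_left strictly_increasing_mul brw_mul_neq_zero)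
qed

section \<open>Finite trees and powers of omega\<close>

lemma brw_of_nat_add: "brw_of_nat m + brw_of_nat n = brw_of_nat (m + n)"
  by (induction n) (simp_all add: brw_add_simps)

lemma brw_of_nat_mul: "brw_of_nat m * brw_of_nat n = brw_of_nat (m * n)"
  by (induction n) (simp_all add: brw_mul_simps brw_of_nat_add add.commute)

lemma brw_omega_neq: "brw_omega \<noteq> brw_zero" "brw_omega \<noteq> brw_succ brw_zero"
  unfolding brw_omega_def by (rule brw_limit_neq[OF strictly_increasing_brw_of_nat])+

lemma brw_omega_exp_neq_zero: "brw_exp brw_omega x \<noteq> brw_zero"
proof (induction x rule: brw_induct)
  case (limit f)
  then show ?case
    by (simp add: brw_exp_simps brw_omega_neq brw_limit_neq strictly_increasing_exp)
qed (simp_all add: brw_exp_simps brw_succ_neq_zero brw_mul_neq_zero brw_omega_neq)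

lemma brw_omega_exp_add:
  "brw_exp brw_omega (x + y) = brw_exp brw_omega x * brw_exp brw_omega y"
  by (induction y rule: brw_induct)
    (simp_all add: brw_add_simps brw_exp_simps brw_mul_one brw_mul_assoc brw_mul_simps
      brw_add_zero_left strictly_increasing_add strictly_increasing_exp brw_omega_neq brw_omega_exp_neq_zero)

lemma brw_omega_exp_one: "brw_exp brw_omega (brw_succ brw_zero) = brw_omega"
proof -
  have "brw_succ brw_zero * brw_of_nat n = brw_of_nat n" for n
    using brw_of_nat_mul[of 1 n] by simp
  then show ?thesis
    unfolding brw_omega_def
    by (simp add: brw_exp_simps brw_mul_simps brw_succ_neq_zero strictly_increasing_brw_of_nat)
qed

lemma brw_omega_exp_absorb:
  "brw_exp brw_omega x + brw_exp brw_omega (brw_succ x + r) = brw_exp brw_omega (brw_succ x + r)"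
proof -
  let ?one = "brw_succ brw_zero" and ?w = "brw_exp brw_omega"
  have "?w r \<noteq> brw_zero" by (rule brw_omega_exp_neq_zero)
  \<comment> \<open>Splitting one off \<open>?w r\<close> puts a bare omega in front of
    \<open>brw_omega * s\<close>; that omega absorbs the one on its left.\<close>
  then obtain s where s: "?w r = ?one + s" by (rule brw_one_add_cases)
  have "?one + brw_omega * ?w r = ?one + brw_omega + brw_omega * s"
    by (simp add: s brw_distrib_left brw_mul_one brw_add_assoc)
  also have "\<dots> = brw_omega * ?w r"
    using brw_one_add_limit[OF strictly_increasing_brw_of_nat]
    by (simp add: s brw_distrib_left brw_mul_one flip: brw_omega_def)
  finally have "?w x * (?one + brw_omega * ?w r) = ?w x * (brw_omega * ?w r)" by simp
  then show ?thesis
    by (simp add: brw_omega_exp_add brw_exp_simps brw_distrib_left brw_mul_one brw_mul_assoc)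
qed

text \<open>Both products are limits of finite multiples, and these interleave: \<open>x * n\<close>
  is at most \<open>y * n\<close>, which is at most \<open>x * (m * n)\<close>.\<close>

lemma brw_mul_omega_eqI:
  assumes "x \<noteq> brw_zero" "x \<le> y" "y \<le> x * brw_of_nat m"
  shows "y * brw_omega = x * brw_omega"
proof -
  have "y * brw_of_nat n \<le> x * brw_of_nat (m * n)" for n
    using brw_mul_mono[OF assms(3) brw_le_refl, of "brw_of_nat n"]
    by (simp add: brw_mul_assoc brw_of_nat_mul)
  moreover have "x * brw_of_nat n \<le> y * brw_of_nat n" for n
    by (intro brw_mul_mono assms brw_le_refl)
  ultimately have "bisimilar (\<lambda>n. y * brw_of_nat n) (\<lambda>n. x * brw_of_nat n)"
    unfolding bisimilar_def by blast
  moreover have "y \<noteq> brw_zero" using assms brw_le_zeroD by blast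
  ultimately show ?thesis
    unfolding brw_omega_def using assms(1) strictly_increasing_brw_of_nat
    by (simp add: brw_mul_simps brw_limit_bisim strictly_increasing_mul)
qed


section \<open>Translating Cantor normal forms\<close>

abbreviation brw_omega_pow :: "tree \<Rightarrow> brw" where
  "brw_omega_pow a \<equiv> brw_exp brw_omega (tree_to_brw a)"

lemma tree_less_trans: "tree_less s t \<Longrightarrow> tree_less t u \<Longrightarrow> tree_less s u"
proof (induction arbitrary: u rule: tree_less.induct)
  case (1 a b)
  then show ?case by cases (auto intro: tree_less.intros)
next
  case (2 a c b d)
  from 2(3) show ?case by cases (auto intro: tree_less.intros 2)
next
  case (3 b d a)
  from 3(3) show ?case by cases (auto intro: tree_less.intros 3)
qed

lemma tree_le_less_trans: "tree_le s t \<Longrightarrow> tree_less t u \<Longrightarrow> tree_less s u"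
  unfolding tree_le_def using tree_less_trans by blast

text \<open>Assumption \<open>IH\<close> is the induction hypothesis of \<open>tree_less_imp_add\<close>, and is discharged by that
  lemma afterwards.\<close>

lemma omega_pow_above_aux:
  assumes "is_cnf c" "c = Leaf \<or> tree_less (left c) b"
    and IH: "\<And>s. size s < size c \<Longrightarrow> is_cnf s \<Longrightarrow> tree_less s b \<Longrightarrow>
      \<exists>r. tree_to_brw b = brw_succ (tree_to_brw s) + r"
  shows "\<exists>r. brw_omega_pow b = brw_succ (tree_to_brw c) + r"
    and "tree_to_brw c + brw_omega_pow b = brw_omega_pow b"
proof -
  have "(\<exists>r. brw_omega_pow b = brw_succ (tree_to_brw c) + r) \<and>
    tree_to_brw c + brw_omega_pow b = brw_omega_pow b"
    using assms
  proof (induction c)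
    case Leaf
    then show ?case
      using brw_one_add_cases[OF brw_omega_exp_neq_zero] brw_add_zero_left
      by (metis tree_to_brw.simps(1))
  next
    case (Node a c)
    have "tree_less a b" using Node.prems by simp
    moreover from this have "c = Leaf \<or> tree_less (left c) b"
      using Node.prems tree_le_less_trans by auto
    ultimately obtain r where r: "brw_omega_pow b = brw_succ (tree_to_brw c) + r"
      and absorb: "tree_to_brw c + brw_omega_pow b = brw_omega_pow b"
      using Node.IH(2) Node.prems by (fastforce simp: less_Suc_eq_le)
    obtain q where q: "tree_to_brw b = brw_succ (tree_to_brw a) + q"
      using Node.prems(3)[of a] Node.prems(1) \<open>tree_less a b\<close> by auto
    have "brw_omega_pow a + brw_omega_pow b = brw_omega_pow b"
      unfolding q by (rule brw_omega_exp_absorb)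
    \<comment> \<open>Prefixing the power of \<open>a\<close> to the equation \<open>r\<close>
      leaves its left side unchanged by absorption, while on the right the power moves inside the
      successor.\<close>
    then show ?case
      using r absorb by (metis brw_add_assoc brw_add_simps(2) tree_to_brw.simps(2))
  qed
  then show "\<exists>r. brw_omega_pow b = brw_succ (tree_to_brw c) + r"
    and "tree_to_brw c + brw_omega_pow b = brw_omega_pow b" by blast+
qed

text \<open>The remainder form is what \<open>brw_omega_exp_absorb\<close> consumes. Induction is on
  size with \<open>t\<close> arbitrary, since smaller normal forms inside \<open>s\<close> get
  compared with the leading exponent of \<open>t\<close>.\<close>

lemma tree_less_imp_add:
  "is_cnf s \<Longrightarrow> tree_less s t \<Longrightarrow> \<exists>r. tree_to_brw t = brw_succ (tree_to_brw s) + r"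
proof (induction s arbitrary: t rule: measure_induct_rule[of size])
  case (less s)
  from less.prems(2) show ?case
  proof cases
    case (1 a b)
    then show ?thesis
      using brw_one_add_cases[OF brw_omega_exp_neq_zero]
      by (metis brw_add_assoc tree_to_brw.simps)
  next
    case (2 a b c d)
    \<comment> \<open>The leading power of \<open>t\<close> alone already exceeds all of
      \<open>s\<close>; the tail of \<open>t\<close> joins the remainder.\<close>
    then have "\<exists>r. brw_omega_pow b = brw_succ (tree_to_brw s) + r"
      using less by (intro omega_pow_above_aux) auto
    with 2 show ?thesis by (metis brw_add_assoc tree_to_brw.simps(2))
  next
    case (3 c d a)
    then have "\<exists>r. tree_to_brw d = brw_succ (tree_to_brw c) + r"
      using less by auto
    with 3 show ?thesis by (metis brw_add_assoc brw_add_simps(2) tree_to_brw.simps(2))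
  qed
qed

lemmas omega_pow_above = omega_pow_above_aux[OF _ _ tree_less_imp_add]

lemma tree_to_brw_add:
  "is_cnf s \<Longrightarrow> is_cnf t \<Longrightarrow> tree_to_brw (tree_add s t) = tree_to_brw s + tree_to_brw t"
proof (induction s t rule: tree_add.induct)
  case (3 a c b d)
  show ?case
  proof (cases "tree_less a b")
    case True
    \<comment> \<open>All exponents on the top level of \<open>Node a c\<close> lie below
      \<open>b\<close>, so the left summand is absorbed whole, just as \<open>tree_add\<close> drops
      it.\<close>
    then have "tree_to_brw (Node a c) + brw_omega_pow b = brw_omega_pow b"
      using 3 by (intro omega_pow_above) auto
    with True show ?thesis by (simp flip: brw_add_assoc)
  qed (use 3 in \<open>simp add: brw_add_assoc\<close>)
qed (simp_all add: brw_add_zero_left brw_add_simps)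

section \<open>Multiplication of normal forms\<close>

lemma brw_le_add: "x \<le> x + (y::brw)"
  using brw_add_mono[OF brw_le_refl brw_le_intros(1)] by (metis brw_add_simps(1))

lemma brw_le_succ: "x \<le> brw_succ x"
  using brw_le_add[of x "brw_succ brw_zero"] by (simp add: brw_add_simps)

text \<open>One copy of the power of \<open>a\<close> pays for each leading term with exponent
  \<open>a\<close>, and one more for the whole rest, which lies below that power.\<close>

lemma cnf_le_omega_pow_mul:
  "is_cnf c \<Longrightarrow> tree_le (left c) a \<Longrightarrow> \<exists>m. tree_to_brw c \<le> brw_omega_pow a * brw_of_nat m"
proof (induction c)
  case Leaf
  then show ?case by (simp add: brw_le_intros(1))
next
  case (Node a' c)
  show ?case
  proof (cases "a' = a")
    case True
    then obtain m where m: "tree_to_brw c \<le> brw_omega_pow a * brw_of_nat m"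
      using Node by auto
    have "tree_to_brw (Node a' c) \<le> brw_omega_pow a + brw_omega_pow a * brw_of_nat m"
      using brw_add_mono[OF brw_le_refl m] True by simp
    also have "brw_omega_pow a + brw_omega_pow a * brw_of_nat m =
        brw_omega_pow a * brw_of_nat (Suc m)"
      using brw_distrib_left[of _ "brw_of_nat 1" "brw_of_nat m"] brw_of_nat_add[of 1 m]
      by (simp add: brw_mul_one)
    finally show ?thesis by blast
  next
    case False
    then have "tree_less a' a" using Node.prems by (simp add: tree_le_def)
    then obtain r where "brw_omega_pow a = brw_succ (tree_to_brw (Node a' c)) + r"
      using omega_pow_above(1)[of "Node a' c" a] Node.prems by auto
    then have "tree_to_brw (Node a' c) \<le> brw_omega_pow a * brw_of_nat 1"
      using brw_le_intros(2)[OF brw_le_succ brw_le_add] by (simp add: brw_mul_one)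
    then show ?thesis by blast
  qed
qed

lemma cnf_mul_omega_exp:
  assumes "is_cnf (Node a c)" "y \<noteq> brw_zero"
  shows "tree_to_brw (Node a c) * brw_exp brw_omega y = brw_exp brw_omega (tree_to_brw a + y)"
proof -
  obtain m where "tree_to_brw (Node a c) \<le> brw_omega_pow a * brw_of_nat m"
    using cnf_le_omega_pow_mul[OF assms(1), of a] by (auto simp: tree_le_def)
  then have "tree_to_brw (Node a c) * brw_omega = brw_omega_pow a * brw_omega"
    by (intro brw_mul_omega_eqI) (simp_all add: brw_omega_exp_neq_zero brw_le_add)
  \<comment> \<open>A nonzero \<open>y\<close> lets one factor omega split off on the left of the
    power, and this factor erases the tail \<open>c\<close>.\<close>
  moreover obtain r where "y = brw_succ brw_zero + r"
    using brw_one_add_cases[OF assms(2)] .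
  ultimately show ?thesis
    by (simp add: brw_omega_exp_add brw_omega_exp_one flip: brw_mul_assoc)
qed

lemma tree_to_brw_mul:
  "is_cnf s \<Longrightarrow> is_cnf t \<Longrightarrow> tree_to_brw (tree_mul s t) = tree_to_brw s * tree_to_brw t"
proof (induction s t rule: tree_mul.induct)
  case (3 a c d)
  \<comment> \<open>The right factor translates to one plus the translation of \<open>d\<close>, so
    left distributivity and the addition result suffice.\<close>
  then show ?case
    using is_cnf_tree_mul[of "Node a c" d] tree_to_brw_add[of "Node a c" "tree_mul (Node a c) d"]
    by (simp add: brw_exp_simps brw_distrib_left brw_mul_one)
next
  case (4 a c b1 b2 d)
  let ?s = "Node a c" and ?b = "Node b1 b2"
  have cnf: "is_cnf a" "is_cnf ?b" "is_cnf ?s" "is_cnf d" using 4 by auto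
  have "is_cnf (Node (tree_add a ?b) Leaf)"
    using is_cnf_tree_add[OF cnf(1,2)] tree_less.intros(1)
    by (cases "tree_add a ?b") (auto simp: tree_le_def)
  \<comment> \<open>The exponent is nonzero, so \<open>cnf_mul_omega_exp\<close> turns the product
    with the leading power into the first summand formed by \<open>tree_mul\<close>.\<close>
  moreover have "tree_to_brw ?b \<noteq> brw_zero"
    using brw_add_eq_zeroD brw_omega_exp_neq_zero by auto
  ultimately show ?case
    using cnf is_cnf_tree_mul[OF cnf(3,4)] 4 cnf_mul_omega_exp[OF cnf(3), of "tree_to_brw ?b"]
    by (simp add: tree_to_brw_add brw_distrib_left brw_add_simps(1)
        del: is_cnf.simps(2) tree_add.simps)
qed (simp_all add: brw_mul_zero_left brw_mul_simps)

theorem theorem8p4: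
  fixes a b :: cnf
  shows "CtoB (a + b) = CtoB a + CtoB b \<and>
         CtoB (a * b) = CtoB a * CtoB b \<and>
         CtoB (cnf_omega_exp a) = brw_exp brw_omega (CtoB a)"
proof -
  have "is_cnf (tree_of_cnf a)" "is_cnf (tree_of_cnf b)"
    using tree_of_cnf by auto
  then show ?thesis
    by (simp add: CtoB_def plus_cnf.rep_eq times_cnf.rep_eq cnf_omega_exp.rep_eq
        tree_to_brw_add tree_to_brw_mul brw_add_simps)
qed

end
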